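(* Let $\mathbf{k}$ be a field of characteristic $0$, let $(A,\mu,\alpha)$ be a Hom-algebra over $\mathbf{k}$, and let $k\ge 2$ be an integer. For $\lambda\in\mathbf{k}$ let $A(\lambda)=(A,\mu_\lambda=\lambda\mu+(1-\lambda)\mu^{op},\alpha)$. Then the following statements hold. (1) $A$ is up to $k$th Hom-power associative if and only if $A(\lambda)$ is up to $k$th Hom-power associative for all $\lambda\in\mathbf{k}$. (2) If $A$ is up to $k$th Hom-power associative, then for every $\lambda\in\mathbf{k}$ the $l$th Hom-powers in $A$ and $A(\lambda)$ coincide for $l\in\{1,\dots,k\}$.
   Context: A Hom-algebra $(A,\mu,\alpha)$ over $\mathbf{k}$ is a $\mathbf{k}$-vector space $A$ with a bilinear map $\mu\colon A^{\otimes 2}\to A$ (no associativity assumed) and a linear map $\alpha\colon A\to A$. The opposite multiplication is $\mu^{op}(x,y)=\mu(y,x)$. Here $\alpha^n$ is the $n$-fold composition, $\alpha^0=Id$. Hom-powers: $x^1=x$ and $x^n=\mu(x^{n-1},\alpha^{n-2}(x))$ for $n\ge 2$. $A$ is $n$th Hom-power associative if $x^n=\mu(\alpha^{n-i-1}(x^i),\alpha^{i-1}(x^{n-i}))$ for all $x\in A$ and $i\in\{1,\dots,n-1\}$; it is up to $n$th Hom-power associative if it is $m$th Hom-power associative for all $m\in\{2,\dots,n\}$. For $A(\lambda)$ these notions are taken with respect to $\mu_\lambda$ and $\alpha$. *)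

theory Defs
  imports Complex_Main
begin

text \<open>The vector space is the whole type \<open>'a\<close>, with scalar multiplication \<open>scale\<close>. No
  associativity of \<open>\<mu>\<close> and no compatibility of \<open>\<alpha>\<close> with \<open>\<mu>\<close> is assumed.\<close>

locale hom_algebra = vector_space scale
  for scale :: "'k::field \<Rightarrow> 'a::ab_group_add \<Rightarrow> 'a" +
  fixes \<mu> :: "'a \<Rightarrow> 'a \<Rightarrow> 'a" and \<alpha> :: "'a \<Rightarrow> 'a"
  assumes linear_mult_right: "\<And>x. Vector_Spaces.linear scale scale (\<lambda>y. \<mu> x y)"
    and linear_mult_left: "\<And>y. Vector_Spaces.linear scale scale (\<lambda>x. \<mu> x y)"
    and linear_twist: "Vector_Spaces.linear scale scale \<alpha>"

definition opp :: "('a \<Rightarrow> 'a \<Rightarrow> 'a) \<Rightarrow> 'a \<Rightarrow> 'a \<Rightarrow> 'a" where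
  "opp \<mu> x y = \<mu> y x"

definition lam_mult ::
  "('k::field \<Rightarrow> 'a::ab_group_add \<Rightarrow> 'a) \<Rightarrow> ('a \<Rightarrow> 'a \<Rightarrow> 'a) \<Rightarrow> 'k \<Rightarrow> 'a \<Rightarrow> 'a \<Rightarrow> 'a" where
  "lam_mult scale \<mu> l x y = scale l (\<mu> x y) + scale (1 - l) (opp \<mu> x y)"

text \<open>Hom-powers are only meaningful for exponents at least 1.\<close>

fun hom_power :: "('a \<Rightarrow> 'a \<Rightarrow> 'a) \<Rightarrow> ('a \<Rightarrow> 'a) \<Rightarrow> 'a \<Rightarrow> nat \<Rightarrow> 'a" where
  "hom_power \<mu> \<alpha> x 0 = undefined"
| "hom_power \<mu> \<alpha> x (Suc 0) = x"
| "hom_power \<mu> \<alpha> x (Suc (Suc n)) = \<mu> (hom_power \<mu> \<alpha> x (Suc n)) ((\<alpha> ^^ n) x)"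

lemma hom_power_1: "hom_power \<mu> \<alpha> x 1 = x"
  by simp

lemma hom_power_rec:
  assumes "n \<ge> 2"
  shows "hom_power \<mu> \<alpha> x n = \<mu> (hom_power \<mu> \<alpha> x (n - 1)) ((\<alpha> ^^ (n - 2)) x)"
proof -
  obtain m where "n = Suc (Suc m)"
    using assms by (metis add_2_eq_Suc le_Suc_ex)
  then show ?thesis by simp
qed

definition hom_power_assoc :: "('a \<Rightarrow> 'a \<Rightarrow> 'a) \<Rightarrow> ('a \<Rightarrow> 'a) \<Rightarrow> nat \<Rightarrow> bool" where
  "hom_power_assoc \<mu> \<alpha> n \<longleftrightarrow>
     (\<forall>x. \<forall>i\<in>{1..n - 1}. hom_power \<mu> \<alpha> x n =
        \<mu> ((\<alpha> ^^ (n - i - 1)) (hom_power \<mu> \<alpha> x i))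
          ((\<alpha> ^^ (i - 1)) (hom_power \<mu> \<alpha> x (n - i))))"

definition up_to_hom_power_assoc :: "('a \<Rightarrow> 'a \<Rightarrow> 'a) \<Rightarrow> ('a \<Rightarrow> 'a) \<Rightarrow> nat \<Rightarrow> bool" where
  "up_to_hom_power_assoc \<mu> \<alpha> n \<longleftrightarrow> (\<forall>m\<in>{2..n}. hom_power_assoc \<mu> \<alpha> m)"

lemma (in hom_algebra) hom_algebra_lam_mult: "hom_algebra scale (lam_mult scale \<mu> l) \<alpha>"
proof -
  interpret p: vector_space_pair scale scale by unfold_locales
  have "Vector_Spaces.linear scale scale (\<lambda>y. lam_mult scale \<mu> l x y)" for x
    unfolding lam_mult_def opp_def
    by (rule p.linear_compose_add[OF p.linear_compose_scale_right[OF linear_mult_right[of x]]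
        p.linear_compose_scale_right[OF linear_mult_left[of x]]])
  moreover have "Vector_Spaces.linear scale scale (\<lambda>y. lam_mult scale \<mu> l y x)" for x
    unfolding lam_mult_def opp_def
    by (rule p.linear_compose_add[OF p.linear_compose_scale_right[OF linear_mult_left[of x]]
        p.linear_compose_scale_right[OF linear_mult_right[of x]]])
  ultimately show ?thesis
    by (intro hom_algebra.intro hom_algebra_axioms.intro vector_space_axioms linear_twist)
qed

end

theory Submission
  imports Defs
begin

text \<open>The defining equations of Hom-power associativity are symmetric under \<open>i \<mapsto> n - i\<close>: that
  exchange turns the two factors of the \<open>i\<close>th product round. Hence each product and its opposite
  are both equal to the Hom-power, and so is the combination of them with weights \<open>l\<close> and \<open>1 - l\<close>,
  which add up to \<open>1\<close>. The case \<open>i = n - 1\<close> says, by induction on the exponent, that \<open>\<mu>\<close> and \<open>lam_mult scale \<mu> l\<close> have the same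
  Hom-powers (\<open>hom_power_lam_mult\<close>). Once this is known, the case of general \<open>i\<close> says
  that the associativity equations pass to \<open>lam_mult scale \<mu> l\<close>
  (\<open>up_to_hom_power_assoc_lam_mult\<close>). The converse is the specialisation \<open>l = 1\<close>, where the
  deformed multiplication is \<open>\<mu>\<close> itself.\<close>

lemma lam_mult_one:
  assumes "vector_space scale"
  shows "lam_mult scale \<mu> 1 = \<mu>"
proof -
  interpret vector_space scale by fact
  show ?thesis by (simp add: fun_eq_iff lam_mult_def)
qed

lemma lam_mult_commuting:
  assumes "vector_space scale" and "\<mu> x y = z" and "\<mu> y x = z"
  shows "lam_mult scale \<mu> l x y = z"
proof -
  interpret vector_space scale by fact
  have "lam_mult scale \<mu> l x y = scale (l + (1 - l)) z"
    unfolding lam_mult_def opp_def assms(2,3) by (rule scale_left_distrib [symmetric])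
  then show ?thesis by simp
qed

lemma hom_power_assocD:
  assumes "hom_power_assoc \<mu> \<alpha> n" and "1 \<le> i" and "i < n"
  shows "\<mu> ((\<alpha> ^^ (n - i - 1)) (hom_power \<mu> \<alpha> x i)) ((\<alpha> ^^ (i - 1)) (hom_power \<mu> \<alpha> x (n - i)))
         = hom_power \<mu> \<alpha> x n"
proof -
  have "i \<in> {1..n - 1}"
    using assms(2,3) by auto
  then show ?thesis
    using assms(1) unfolding hom_power_assoc_def by metis
qed

text \<open>This is the defining equation for the index \<open>n - i\<close>, where \<open>n - (n - i) - 1 = i - 1\<close>.\<close>

lemma hom_power_assoc_swapD:
  assumes "hom_power_assoc \<mu> \<alpha> n" and "1 \<le> i" and "i < n"
  shows "\<mu> ((\<alpha> ^^ (i - 1)) (hom_power \<mu> \<alpha> x (n - i))) ((\<alpha> ^^ (n - i - 1)) (hom_power \<mu> \<alpha> x i))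
         = hom_power \<mu> \<alpha> x n"
  using hom_power_assocD [OF assms(1), of "n - i" x] assms(2,3) by simp

lemma lam_mult_hom_power_factors:
  assumes "vector_space scale" and "hom_power_assoc \<mu> \<alpha> n" and "1 \<le> i" and "i < n"
  shows "lam_mult scale \<mu> l ((\<alpha> ^^ (n - i - 1)) (hom_power \<mu> \<alpha> x i))
           ((\<alpha> ^^ (i - 1)) (hom_power \<mu> \<alpha> x (n - i))) = hom_power \<mu> \<alpha> x n"
  by (intro lam_mult_commuting assms hom_power_assocD hom_power_assoc_swapD)

text \<open>The recursion for Hom-powers multiplies by a twisted \<open>x\<close> on the right, which is the
  factorisation with \<open>i = n - 1\<close>; so the powers agree by induction, level by level.\<close>

lemma hom_power_lam_mult:
  assumes "vector_space scale" and "up_to_hom_power_assoc \<mu> \<alpha> k" and "1 \<le> n" and "n \<le> k"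
  shows "hom_power (lam_mult scale \<mu> l) \<alpha> x n = hom_power \<mu> \<alpha> x n"
  using assms(3,4)
proof (induction n rule: nat_induct_at_least)
  case base
  show ?case by simp
next
  case (Suc n)
  have "hom_power_assoc \<mu> \<alpha> (Suc n)"
    using assms(2) Suc unfolding up_to_hom_power_assoc_def by simp
  then have "lam_mult scale \<mu> l (hom_power \<mu> \<alpha> x n) ((\<alpha> ^^ (n - 1)) x) = hom_power \<mu> \<alpha> x (Suc n)"
    using lam_mult_hom_power_factors [OF assms(1), of \<mu> \<alpha> "Suc n" n l x] Suc.hyps by simp
  moreover have "hom_power (lam_mult scale \<mu> l) \<alpha> x n = hom_power \<mu> \<alpha> x n"
    using Suc by simp
  ultimately show ?case
    using hom_power_rec [of "Suc n" "lam_mult scale \<mu> l" \<alpha> x] Suc.hyps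
    by (simp add: numeral_2_eq_2)
qed

lemma up_to_hom_power_assoc_lam_mult:
  assumes "vector_space scale" and "up_to_hom_power_assoc \<mu> \<alpha> k"
  shows "up_to_hom_power_assoc (lam_mult scale \<mu> l) \<alpha> k"
  unfolding up_to_hom_power_assoc_def hom_power_assoc_def
proof (intro ballI allI)
  fix m x i
  assume m: "m \<in> {2..k}" and i: "i \<in> {1..m - 1}"
  have "hom_power_assoc \<mu> \<alpha> m"
    using assms(2) m unfolding up_to_hom_power_assoc_def by blast
  then have "lam_mult scale \<mu> l ((\<alpha> ^^ (m - i - 1)) (hom_power \<mu> \<alpha> x i))
      ((\<alpha> ^^ (i - 1)) (hom_power \<mu> \<alpha> x (m - i))) = hom_power \<mu> \<alpha> x m"
    using i by (intro lam_mult_hom_power_factors assms(1)) auto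
  moreover have "hom_power (lam_mult scale \<mu> l) \<alpha> x j = hom_power \<mu> \<alpha> x j"
    if "j \<in> {i, m - i, m}" for j
    using that m i by (intro hom_power_lam_mult [OF assms]) auto
  ultimately show "hom_power (lam_mult scale \<mu> l) \<alpha> x m =
      lam_mult scale \<mu> l ((\<alpha> ^^ (m - i - 1)) (hom_power (lam_mult scale \<mu> l) \<alpha> x i))
        ((\<alpha> ^^ (i - 1)) (hom_power (lam_mult scale \<mu> l) \<alpha> x (m - i)))"
    by simp
qed

theorem theorem2p9:
  fixes scale :: "'k::field_char_0 \<Rightarrow> 'a::ab_group_add \<Rightarrow> 'a"
    and \<mu> :: "'a \<Rightarrow> 'a \<Rightarrow> 'a" and \<alpha> :: "'a \<Rightarrow> 'a" and k :: nat
  assumes "hom_algebra scale \<mu> \<alpha>"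
    and "k \<ge> 2"
  shows "(up_to_hom_power_assoc \<mu> \<alpha> k \<longleftrightarrow>
            (\<forall>l::'k. up_to_hom_power_assoc (lam_mult scale \<mu> l) \<alpha> k)) \<and>
         (up_to_hom_power_assoc \<mu> \<alpha> k \<longrightarrow>
            (\<forall>l::'k. \<forall>n\<in>{1..k}. \<forall>x.
               hom_power (lam_mult scale \<mu> l) \<alpha> x n = hom_power \<mu> \<alpha> x n))"
proof -
  have vs: "vector_space scale"
    using assms(1) by (rule hom_algebra.axioms(1))
  have "up_to_hom_power_assoc \<mu> \<alpha> k"
    if "\<forall>l::'k. up_to_hom_power_assoc (lam_mult scale \<mu> l) \<alpha> k"
    using that [rule_format, of 1] by (simp only: lam_mult_one [OF vs])
  then show ?thesis
    using up_to_hom_power_assoc_lam_mult [OF vs] hom_power_lam_mult [OF vs] by auto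
qed

end
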